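(* Let $n\ge 1$ and let $M$ be an integer with $2<M<2^n$ that is not a power of $2$. Write $M=\sum_{j=0}^{k}2^{l_j}$ with integers $0\le l_0<l_1<\dots<l_k\le n-1$. Then the $n$-qubit circuit $U_M$ produced by the algorithm $\mathrm{Uniform}(M)$ (defined in the context) satisfies $$U_M|0\rangle^{\otimes n}=\frac{1}{\sqrt{M}}\sum_{j=0}^{M-1}|j\rangle .$$
   Context: Qubits are labelled $q_{n-1},\dots,q_0$, and for an integer $0\le j<2^n$ with binary expansion $j=\sum_{i=0}^{n-1}j_i2^i$, $|j\rangle$ denotes the computational basis state $|j_{n-1}\rangle\otimes\cdots\otimes|j_0\rangle$, where $j_i$ is the value of qubit $q_i$. $X$ is the Pauli-$X$ gate, $H$ is the Hadamard gate, and $$R_Y(\theta)=\begin{bmatrix}\cos\frac{\theta}{2}&-\sin\frac{\theta}{2}\\ \sin\frac{\theta}{2}&\cos\frac{\theta}{2}\end{bmatrix}.$$ A single-qubit gate $V$ applied to a target qubit "conditioned on $q_c$ being $0$" means the two-qubit gate applying $V$ to the target if the control qubit $q_c$ is $|0\rangle$ and the identity if it is $|1\rangle$. Algorithm $\mathrm{Uniform}(M)$. Start from $|q_{n-1}\rangle\otimes\cdots\otimes|q_0\rangle=|0\rangle^{\otimes n}$ and apply the following gates in order. 1. Apply $X$ to $q_i$ for $i=l_1,l_2,\dots,l_k$. 2. Set $M_0=2^{l_0}$. If $l_0>0$, apply $H$ to $q_i$ for $i=0,1,\dots,l_0-1$. 3. Apply $R_Y(\theta_0)$ to $q_{l_1}$,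 where $\theta_0=-2\arccos\left(\sqrt{M_0/M}\right)$. 4. Apply $H$ to $q_i$ for each $i=l_0,l_0+1,\dots,l_1-1$, conditioned on $q_{l_1}$ being $0$. 5. For $m=1,2,\dots,k-1$ (in this order): (a) apply $R_Y(\theta_m)$ to $q_{l_{m+1}}$ conditioned on $q_{l_m}$ being $0$, where $\theta_m=-2\arccos\left(\sqrt{\frac{2^{l_m}}{M-M_{m-1}}}\right)$; (b) apply $H$ to $q_i$ for each $i=l_m,l_m+1,\dots,l_{m+1}-1$, conditioned on $q_{l_{m+1}}$ being $0$; (c) set $M_m=M_{m-1}+2^{l_m}$. $U_M$ denotes the resulting unitary operator. *)

theory Defs
  imports "HOL-Analysis.Analysis" "Jordan_Normal_Form.Matrix"
begin

definition kron_vec :: "complex vec \<Rightarrow> complex vec \<Rightarrow> complex vec" where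
  "kron_vec u v =
     vec (dim_vec u * dim_vec v) (\<lambda>i. u $ (i div dim_vec v) * v $ (i mod dim_vec v))"

definition kron_mat :: "complex mat \<Rightarrow> complex mat \<Rightarrow> complex mat" where
  "kron_mat A B =
     mat (dim_row A * dim_row B) (dim_col A * dim_col B)
       (\<lambda>(i, j). A $$ (i div dim_row B, j div dim_col B) * B $$ (i mod dim_row B, j mod dim_col B))"

text \<open>The factor of the qubit with the highest index stands leftmost. Bits of \<open>j\<close> at
  positions \<open>\<ge> n\<close> are ignored, so \<open>ket n j\<close> is meant for \<open>j < 2 ^ n\<close>.\<close>

primrec ket :: "nat \<Rightarrow> nat \<Rightarrow> complex vec" where
  "ket 0 j = unit_vec 1 0"
| "ket (Suc n) j = kron_vec (unit_vec 2 (j div 2 ^ n mod 2)) (ket n j)"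

lemma dim_vec_ket [simp]: "dim_vec (ket n j) = 2 ^ n"
  by (induction n) (simp_all add: kron_vec_def)

lemma ket_eq_unit_vec_mod: "ket n j = unit_vec (2 ^ n) (j mod 2 ^ n)"
proof (induction n)
  case 0
  show ?case by simp
next
  case (Suc n)
  have split: "j mod 2 ^ Suc n = 2 ^ n * (j div 2 ^ n mod 2) + j mod 2 ^ n"
    by (metis mod_mult2_eq mult.commute power_Suc)
  show ?case
  proof (rule eq_vecI)
    fix i assume "i < dim_vec (unit_vec (2 ^ Suc n) (j mod 2 ^ Suc n) :: complex vec)"
    then have i: "i < 2 * 2 ^ n" by simp
    then have i2: "i div 2 ^ n < 2" by (simp add: less_mult_imp_div_less)
    have "i = j mod 2 ^ Suc n \<longleftrightarrow>
        i div 2 ^ n = j div 2 ^ n mod 2 \<and> i mod 2 ^ n = j mod 2 ^ n"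
      unfolding split
      by (metis div_mult_self4 div_less mod_less_divisor mod_mult_self4 mod_mod_trivial
          mult_div_mod_eq pos2 zero_less_power add_0_right power_not_zero zero_neq_numeral)
    then show "ket (Suc n) j $ i = unit_vec (2 ^ Suc n) (j mod 2 ^ Suc n) $ i"
      using i i2 by (auto simp: kron_vec_def Suc.IH unit_vec_def)
  qed (simp add: kron_vec_def)
qed

lemma ket_eq_unit_vec: "j < 2 ^ n \<Longrightarrow> ket n j = unit_vec (2 ^ n) j"
  by (simp add: ket_eq_unit_vec_mod)

definition gate_X :: "complex mat" where
  "gate_X = mat_of_rows_list 2 [[0, 1], [1, 0]]"

definition gate_H :: "complex mat" where
  "gate_H = complex_of_real (1 / sqrt 2) \<cdot>\<^sub>m mat_of_rows_list 2 [[1, 1], [1, -1]]"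

definition gate_RY :: "real \<Rightarrow> complex mat" where
  "gate_RY \<theta> = mat_of_rows_list 2
     (map (map complex_of_real)
       [[cos (\<theta> / 2), - sin (\<theta> / 2)], [sin (\<theta> / 2), cos (\<theta> / 2)]])"

definition proj0 :: "complex mat" where
  "proj0 = mat_of_rows_list 2 [[1, 0], [0, 0]]"

definition proj1 :: "complex mat" where
  "proj1 = mat_of_rows_list 2 [[0, 0], [0, 1]]"

text \<open>A single-qubit operator \<open>V\<close> on qubit \<open>i < n\<close> of an \<open>n\<close>-qubit register.\<close>

definition on_qubit :: "nat \<Rightarrow> nat \<Rightarrow> complex mat \<Rightarrow> complex mat" where
  "on_qubit n i V = kron_mat (1\<^sub>m (2 ^ (n - 1 - i))) (kron_mat V (1\<^sub>m (2 ^ i)))"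

text \<open>\<open>V\<close> on the target \<open>t\<close> conditioned on the control \<open>c \<noteq> t\<close> being 0, that is,
  \<open>|0><0|\<close> on \<open>c\<close> with \<open>V\<close> on \<open>t\<close>, plus \<open>|1><1|\<close> on \<open>c\<close> with the identity on \<open>t\<close>.\<close>

definition on_qubit_if0 :: "nat \<Rightarrow> nat \<Rightarrow> nat \<Rightarrow> complex mat \<Rightarrow> complex mat" where
  "on_qubit_if0 n c t V = on_qubit n c proj0 * on_qubit n t V + on_qubit n c proj1"

primrec partial_M :: "(nat \<Rightarrow> nat) \<Rightarrow> nat \<Rightarrow> nat" where
  "partial_M l 0 = 2 ^ l 0"
| "partial_M l (Suc m) = partial_M l m + 2 ^ l (Suc m)"

definition rotation_angle :: "nat \<Rightarrow> (nat \<Rightarrow> nat) \<Rightarrow> nat \<Rightarrow> real" where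
  "rotation_angle M l m =
     (if m = 0 then - 2 * arccos (sqrt (real (partial_M l 0) / real M))
      else - 2 * arccos (sqrt (2 ^ l m / (real M - real (partial_M l (m - 1))))))"

text \<open>The gates in the order of application, where \<open>l 0 < \<dots> < l k\<close> are the positions of the
  ones in the binary expansion of \<open>M\<close>.\<close>

definition uniform_gates :: "nat \<Rightarrow> nat \<Rightarrow> nat \<Rightarrow> (nat \<Rightarrow> nat) \<Rightarrow> complex mat list" where
  "uniform_gates n M k l =
     map (\<lambda>j. on_qubit n (l j) gate_X) [1..<k + 1]
   @ (if l 0 > 0 then map (\<lambda>i. on_qubit n i gate_H) [0..<l 0] else [])
   @ [on_qubit n (l 1) (gate_RY (rotation_angle M l 0))]
   @ map (\<lambda>i. on_qubit_if0 n (l 1) i gate_H) [l 0..<l 1]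
   @ concat (map (\<lambda>m.
         on_qubit_if0 n (l m) (l (m + 1)) (gate_RY (rotation_angle M l m))
         # map (\<lambda>i. on_qubit_if0 n (l (m + 1)) i gate_H) [l m..<l (m + 1)])
       [1..<k])"

definition circuit :: "nat \<Rightarrow> complex mat list \<Rightarrow> complex mat" where
  "circuit n gs = foldl (\<lambda>U G. G * U) (1\<^sub>m (2 ^ n)) gs"

definition uniform_unitary :: "nat \<Rightarrow> nat \<Rightarrow> nat \<Rightarrow> (nat \<Rightarrow> nat) \<Rightarrow> complex mat" where
  "uniform_unitary n M k l = circuit n (uniform_gates n M k l)"

end

(* After the X gates and the Hadamards on the low qubits, the register is uniform on
   the 2^(l 0) basis states in [M - 2^(l 0), M). The intervals I_m = [M - M_m, M - M_m + 2^(l m))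
   are adjacent and fill [0, M) from the top down; I_m consists of the j that agree with M
   above bit l m and have bit l m equal to 0. Round m keeps the final amplitude 1 / sqrt M on I_m
   and rotates the remaining amplitude by clearing bit l (m+1); the following Hadamards spread it
   over I_(m+1). The control qubit separates I_m from the finished intervals, on which it is 1. *)
theory Submission
  imports Defs
begin

section \<open>Gates as linear maps on amplitude functions\<close>

text \<open>\<open>V\<close> on qubit \<open>t\<close>, controlled by the predicate \<open>P\<close> on basis states, as a map on amplitude
  functions; \<open>P\<close> must not depend on bit \<open>t\<close>.\<close>

definition act :: "(nat \<Rightarrow> bool) \<Rightarrow> nat \<Rightarrow> complex mat \<Rightarrow> (nat \<Rightarrow> complex) \<Rightarrow> nat \<Rightarrow> complex" where
  "act P t V f x =
     (if P x then V $$ (of_bool (bit x t), 0) * f (unset_bit t x)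
                + V $$ (of_bool (bit x t), 1) * f (set_bit t x)
      else f x)"

lemma set_bit_less_power2:
  fixes x :: nat
  assumes "x < 2 ^ n" "i < n"
  shows "set_bit i x < 2 ^ n" "unset_bit i x < 2 ^ n"
  using assms unfolding take_bit_nat_eq_self_iff[symmetric]
  by (auto simp: bit_eq_iff[of "take_bit _ _"] bit_simps)

lemma unset_bit_neq_set_bit: "unset_bit i x \<noteq> (set_bit i x :: nat)"
  by (auto simp: bit_eq_iff bit_simps)

lemma set_bit_idle:
  fixes x :: nat
  shows "bit x i \<Longrightarrow> set_bit i x = x" "\<not> bit x i \<Longrightarrow> unset_bit i x = x"
  by (auto intro!: bit_eqI simp: bit_simps)

text \<open>Both sides say that \<open>x\<close> and \<open>y\<close> agree in every bit except
  possibly bit \<open>i\<close>; the left one is what the identity factors around a one-qubit gate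
  impose.\<close>

lemma equal_outside_bit_iff:
  fixes x y :: nat
  shows "x div 2 ^ Suc i = y div 2 ^ Suc i \<and> x mod 2 ^ i = y mod 2 ^ i \<longleftrightarrow>
    y = unset_bit i x \<or> y = set_bit i x"
proof -
  have "x div 2 ^ Suc i = y div 2 ^ Suc i \<and> x mod 2 ^ i = y mod 2 ^ i \<longleftrightarrow>
      (\<forall>j. bit x (Suc i + j) = bit y (Suc i + j)) \<and> (\<forall>j<i. bit x j = bit y j)"
    unfolding drop_bit_eq_div[symmetric] take_bit_eq_mod[symmetric]
    by (auto simp: bit_eq_iff bit_simps)
  also have "\<dots> \<longleftrightarrow> (\<forall>j. j \<noteq> i \<longrightarrow> bit x j = bit y j)"
    (is "?l = ?r")
  proof
    assume l: ?l
    show ?r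
    proof (intro allI impI)
      fix j assume "j \<noteq> i"
      then consider "j < i" | "Suc i \<le> j" by linarith
      then show "bit x j = bit y j"
      proof cases
        case 2
        then show ?thesis using l le_Suc_ex by blast
      qed (use l in simp)
    qed
  qed simp
  also have "\<dots> \<longleftrightarrow> y = unset_bit i x \<or> y = set_bit i x"
    by (cases "bit y i"; simp add: bit_eq_iff[of y] bit_simps; metis)
  finally show ?thesis .
qed

lemma power2_split:
  assumes "i < n"
  shows "(2 ^ n :: nat) = 2 ^ (n - 1 - i) * (2 * 2 ^ i)"
proof -
  have "n = (n - 1 - i) + Suc i"
    using assms by simp
  then have "(2 ^ n :: nat) = 2 ^ ((n - 1 - i) + Suc i)"
    by metis
  then show ?thesis
    by (simp only: power_add power_Suc)
qed

lemma kron_mat_carrier: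
  assumes "A \<in> carrier_mat r c" "B \<in> carrier_mat r' c'"
  shows "kron_mat A B \<in> carrier_mat (r * r') (c * c')"
  unfolding kron_mat_def carrier_matD[OF assms(1)] carrier_matD[OF assms(2)]
  by (rule mat_carrier)

lemma kron_mat_index:
  assumes "A \<in> carrier_mat r c" "B \<in> carrier_mat r' c'" "i < r * r'" "j < c * c'"
  shows "kron_mat A B $$ (i, j) = A $$ (i div r', j div c') * B $$ (i mod r', j mod c')"
  unfolding kron_mat_def carrier_matD[OF assms(1)] carrier_matD[OF assms(2)]
  using assms(3,4) by simp

lemma on_qubit_carrier:
  assumes "i < n" "V \<in> carrier_mat 2 2"
  shows "on_qubit n i V \<in> carrier_mat (2 ^ n) (2 ^ n)"
  unfolding on_qubit_def power2_split[OF assms(1)]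
  by (intro kron_mat_carrier one_carrier_mat assms(2))

text \<open>The identity factors force row and column to agree outside bit \<open>i\<close>; the
  factor \<open>V\<close> is indexed by bit \<open>i\<close> of each.\<close>

lemma on_qubit_index:
  assumes i: "i < n" and V: "V \<in> carrier_mat 2 2" and x: "x < 2 ^ n" and y: "y < 2 ^ n"
  shows "on_qubit n i V $$ (x, y) =
    (if y = unset_bit i x \<or> y = set_bit i x
     then V $$ (of_bool (bit x i), of_bool (bit y i)) else 0)"
proof -
  have N: "(2 ^ n :: nat) = 2 ^ (n - 1 - i) * (2 * 2 ^ i)"
    using power2_split[OF i] .
  \<comment> \<open>An index has three digits, for the qubits above \<open>i\<close>, qubit
    \<open>i\<close> and those below; the middle digit is bit \<open>i\<close>.\<close>
  have *: "z mod (2 * 2 ^ i) div 2 ^ i = of_bool (bit z i)" for z :: nat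
  proof -
    have "z mod (2 * 2 ^ i) div 2 ^ i = z div 2 ^ i mod 2"
      by (subst mult.commute, subst mod_mult2_eq) simp
    then show ?thesis
      by (simp add: bit_iff_odd mod_2_eq_odd)
  qed
  have **: "z mod (2 * 2 ^ i) mod 2 ^ i = z mod 2 ^ i" for z :: nat
    by (simp add: mod_mod_cancel)
  have d: "z div (2 * 2 ^ i) < 2 ^ (n - 1 - i)" if "z < 2 ^ n" for z :: nat
    using that unfolding N by (rule less_mult_imp_div_less)
  have "on_qubit n i V $$ (x, y) =
      (if x div 2 ^ Suc i = y div 2 ^ Suc i \<and> x mod 2 ^ i = y mod 2 ^ i
       then V $$ (of_bool (bit x i), of_bool (bit y i)) else 0)"
  proof -
    have "on_qubit n i V $$ (x, y) =
        1\<^sub>m (2 ^ (n - 1 - i)) $$ (x div (2 * 2 ^ i), y div (2 * 2 ^ i))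
        * kron_mat V (1\<^sub>m (2 ^ i)) $$ (x mod (2 * 2 ^ i), y mod (2 * 2 ^ i))"
      unfolding on_qubit_def
      by (rule kron_mat_index[OF one_carrier_mat kron_mat_carrier[OF V one_carrier_mat]
            x[unfolded N] y[unfolded N]])
    also have "kron_mat V (1\<^sub>m (2 ^ i)) $$ (x mod (2 * 2 ^ i), y mod (2 * 2 ^ i)) =
        V $$ (of_bool (bit x i), of_bool (bit y i)) * 1\<^sub>m (2 ^ i) $$ (x mod 2 ^ i, y mod 2 ^ i)"
      by (subst kron_mat_index[OF V one_carrier_mat]) (simp_all only: * **, simp_all)
    also have "1\<^sub>m (2 ^ i) $$ (x mod 2 ^ i, y mod 2 ^ i) =
        (if x mod 2 ^ i = y mod 2 ^ i then 1 else 0 :: complex)"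
      by (rule index_one_mat(1)) simp_all
    also have "1\<^sub>m (2 ^ (n - 1 - i)) $$ (x div (2 * 2 ^ i), y div (2 * 2 ^ i)) =
        (if x div (2 * 2 ^ i) = y div (2 * 2 ^ i) then 1 else 0 :: complex)"
      by (rule index_one_mat(1)[OF d[OF x] d[OF y]])
    finally show ?thesis
      by (cases "x div (2 * 2 ^ i) = y div (2 * 2 ^ i)"; cases "x mod 2 ^ i = y mod 2 ^ i") simp_all
  qed
  then show ?thesis
    unfolding equal_outside_bit_iff .
qed

text \<open>Row \<open>x\<close> can be nonzero only in the columns \<open>unset_bit i x\<close> and
  \<open>set_bit i x\<close>, which leaves the two terms of \<open>act\<close>.\<close>

lemma on_qubit_mult_vec:
  assumes i: "i < n" and V: "V \<in> carrier_mat 2 2"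
  shows "on_qubit n i V *\<^sub>v vec (2 ^ n) f = vec (2 ^ n) (act (\<lambda>_. True) i V f)"
proof (rule eq_vecI)
  fix x assume "x < dim_vec (vec (2 ^ n) (act (\<lambda>_. True) i V f))"
  then have x: "x < 2 ^ n" by simp
  let ?u = "unset_bit i x" and ?s = "set_bit i x"
  have "(on_qubit n i V *\<^sub>v vec (2 ^ n) f) $ x =
      (\<Sum>y = 0..<2 ^ n. on_qubit n i V $$ (x, y) * f y)"
    using on_qubit_carrier[OF i V] x by (simp add: scalar_prod_def)
  also have "\<dots> = (\<Sum>y \<in> {?u, ?s}. on_qubit n i V $$ (x, y) * f y)"
    by (rule sum.mono_neutral_right)
      (auto simp: set_bit_less_power2 x i on_qubit_index[OF i V x])
  also have "\<dots> = act (\<lambda>_. True) i V f x"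
    using unset_bit_neq_set_bit[of i x]
    by (simp add: on_qubit_index[OF i V x] set_bit_less_power2 x i act_def bit_simps)
  finally show "(on_qubit n i V *\<^sub>v vec (2 ^ n) f) $ x = vec (2 ^ n) (act (\<lambda>_. True) i V f) $ x"
    using x by simp
qed (use on_qubit_carrier[OF i V] in simp)

lemma gate_carrier [simp]:
  "gate_X \<in> carrier_mat 2 2" "gate_H \<in> carrier_mat 2 2" "gate_RY \<theta> \<in> carrier_mat 2 2"
  "proj0 \<in> carrier_mat 2 2" "proj1 \<in> carrier_mat 2 2"
  by (auto simp: gate_X_def gate_H_def gate_RY_def proj0_def proj1_def mat_of_rows_list_def)

lemma on_qubit_if0_carrier:
  assumes "c < n" "t < n" "V \<in> carrier_mat 2 2"
  shows "on_qubit_if0 n c t V \<in> carrier_mat (2 ^ n) (2 ^ n)"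
  using assms unfolding on_qubit_if0_def
  by (intro add_carrier_mat mult_carrier_mat on_qubit_carrier) auto

lemma act_proj0: "act (\<lambda>_. True) c proj0 f x = (if bit x c then 0 else f x)"
  by (auto simp: act_def proj0_def mat_of_rows_list_def set_bit_idle)

lemma act_proj1: "act (\<lambda>_. True) c proj1 f x = (if bit x c then f x else 0)"
  by (auto simp: act_def proj1_def mat_of_rows_list_def set_bit_idle)

text \<open>\<open>proj0\<close> keeps the transformed amplitudes where bit \<open>c\<close> is 0,
  and \<open>proj1\<close> the old ones where it is 1.\<close>

lemma on_qubit_if0_mult_vec:
  assumes c: "c < n" and t: "t < n" and V: "V \<in> carrier_mat 2 2"
  shows "on_qubit_if0 n c t V *\<^sub>v vec (2 ^ n) f = vec (2 ^ n) (act (\<lambda>x. \<not> bit x c) t V f)"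
proof -
  have "on_qubit_if0 n c t V *\<^sub>v vec (2 ^ n) f =
      on_qubit n c proj0 *\<^sub>v (on_qubit n t V *\<^sub>v vec (2 ^ n) f)
      + on_qubit n c proj1 *\<^sub>v vec (2 ^ n) f"
    unfolding on_qubit_if0_def
    using on_qubit_carrier[OF c gate_carrier(4)] on_qubit_carrier[OF c gate_carrier(5)]
      on_qubit_carrier[OF t V]
    by (subst add_mult_distrib_mat_vec[where nr = "2 ^ n" and nc = "2 ^ n"])
      (auto intro!: mult_carrier_mat assoc_mult_mat_vec
        arg_cong[where f = "\<lambda>v. v + on_qubit n c proj1 *\<^sub>v vec (2 ^ n) f"])
  also have "\<dots> = vec (2 ^ n) (act (\<lambda>x. \<not> bit x c) t V f)"
    by (rule eq_vecI)
      (auto simp: on_qubit_mult_vec c t V act_proj0 act_proj1, auto simp: act_def)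
  finally show ?thesis .
qed

lemma circuit_mult_vec:
  assumes "\<forall>G \<in> set gs. G \<in> carrier_mat (2 ^ n) (2 ^ n)" "v \<in> carrier_vec (2 ^ n)"
  shows "circuit n gs *\<^sub>v v = foldl (\<lambda>v G. G *\<^sub>v v) v gs"
proof -
  have "foldl (\<lambda>U G. G * U) U gs *\<^sub>v v = foldl (\<lambda>v G. G *\<^sub>v v) (U *\<^sub>v v) gs"
    if "U \<in> carrier_mat (2 ^ n) (2 ^ n)" for U
    using assms that
  proof (induction gs arbitrary: U)
    case (Cons G gs)
    then show ?case
      by (simp add: assoc_mult_mat_vec[where ?n\<^sub>1.0 = "2 ^ n" and ?n\<^sub>2.0 = "2 ^ n" and ?n\<^sub>3.0 = "2 ^ n"]
          mult_carrier_mat[where nr = "2 ^ n" and n = "2 ^ n" and nc = "2 ^ n"])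
  qed simp
  from this[of "1\<^sub>m (2 ^ n)"] show ?thesis
    using assms(2) by (simp add: circuit_def)
qed

section \<open>Two-level amplitude functions on dyadic blocks\<close>

text \<open>A dyadic interval of length \<open>2 ^ i\<close>, described by its fixed high bits so
  that the effect of a gate on a single bit is easy to follow.\<close>

definition block :: "nat \<Rightarrow> nat \<Rightarrow> nat set" where
  "block i T = {x. \<forall>j\<ge>i. bit x j = bit T j}"

text \<open>The shape of the state throughout the rounds: the final amplitude \<open>a\<close> on
  the finished set \<open>A\<close>, and \<open>b\<close> on the block \<open>B\<close> still to be
  processed.\<close>

definition two_level :: "complex \<Rightarrow> nat set \<Rightarrow> complex \<Rightarrow> nat set \<Rightarrow> nat \<Rightarrow> complex" where
  "two_level a A b B x = (if x \<in> A then a else if x \<in> B then b else 0)"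

text \<open>Without low bits \<open>T\<close> is a multiple of \<open>2 ^ i\<close>, so agreeing
  with it from bit \<open>i\<close> on means having the same quotient by
  \<open>2 ^ i\<close>.\<close>

lemma block_eq_atLeastLessThan:
  assumes "\<And>j. j < i \<Longrightarrow> \<not> bit T j"
  shows "block i T = {T..<T + 2 ^ i}"
proof -
  have "take_bit i T = 0"
    using assms by (auto simp: bit_eq_iff bit_simps)
  then have "2 ^ i dvd T"
    by (simp add: take_bit_eq_mod dvd_eq_mod_eq_0)
  then obtain q where T: "T = 2 ^ i * q" ..
  have "x \<in> block i T \<longleftrightarrow> drop_bit i x = drop_bit i T" for x
    by (auto simp: block_def bit_eq_iff bit_simps dest: le_Suc_ex)
  also have "\<dots> x \<longleftrightarrow> x div 2 ^ i = q" for x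
    by (simp add: drop_bit_eq_div T)
  also have "\<dots> x \<longleftrightarrow> T \<le> x \<and> x < T + 2 ^ i" for x
    unfolding T by (auto simp: div_nat_eqI dividend_less_times_div algebra_simps)
  finally show ?thesis by (simp only: set_eq_iff atLeastLessThan_iff simp_thms)
qed

text \<open>\<open>block 0 T\<close> is the singleton of \<open>T\<close>, so this flips one bit of
  a multiple of a basis state.\<close>

lemma act_X_two_level:
  assumes "\<not> bit T i"
  shows "act (\<lambda>_. True) i gate_X (two_level 0 {} b (block 0 T))
    = two_level 0 {} b (block 0 (set_bit i T))"
proof
  fix x
  show "act (\<lambda>_. True) i gate_X (two_level 0 {} b (block 0 T)) x
    = two_level 0 {} b (block 0 (set_bit i T)) x"
    using assms
    by (auto simp: act_def two_level_def gate_X_def mat_of_rows_list_def block_def bit_simps)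
qed

text \<open>Of each pair differing in bit \<open>i\<close> only the member with a 0 there can carry
  \<open>b\<close>, since \<open>T\<close> has a 0 there; \<open>gate_H\<close> shares it equally
  over both. The assumptions on \<open>P\<close> keep \<open>A\<close> untouched and the whole block
  active.\<close>

lemma act_H_two_level:
  assumes A: "\<And>x. P x \<Longrightarrow> x \<notin> A"
    and P: "\<And>x. P (unset_bit i x) = P x" "\<And>x. P (set_bit i x) = P x"
    and B: "block (Suc i) T \<subseteq> Collect P" and T: "\<not> bit T i"
  shows "act P i gate_H (two_level a A b (block i T))
    = two_level a A (b / complex_of_real (sqrt 2)) (block (Suc i) T)"
proof
  fix x
  have u: "unset_bit i x \<in> block i T \<longleftrightarrow> x \<in> block (Suc i) T"
  proof -
    have "i \<le> j \<longleftrightarrow> j = i \<or> Suc i \<le> j" for j by auto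
    then show ?thesis using T by (auto simp: block_def bit_simps)
  qed
  have s: "set_bit i x \<notin> block i T"
    using T by (auto simp: block_def bit_simps)
  have sub: "x \<in> block i T \<Longrightarrow> x \<in> block (Suc i) T"
    by (auto simp: block_def)
  show "act P i gate_H (two_level a A b (block i T)) x
    = two_level a A (b / complex_of_real (sqrt 2)) (block (Suc i) T) x"
    using A[of x] A[of "unset_bit i x"] A[of "set_bit i x"] P[of x] u s B sub
    by (auto simp: act_def two_level_def gate_H_def mat_of_rows_list_def)
qed

text \<open>On the block bit \<open>t\<close> is 1, and \<open>gate_RY\<close> sends |1> to
  \<open>- sin\<close> times |0> plus \<open>cos\<close> times |1>. The part that keeps the 1 joins
  \<open>A\<close>, because its amplitude is assumed to be \<open>a\<close>; the part with 0 fills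
  \<open>block i T\<close>.\<close>

lemma act_RY_two_level:
  assumes A: "\<And>x. P x \<Longrightarrow> x \<notin> A"
    and P: "\<And>x. P (unset_bit t x) = P x" "\<And>x. P (set_bit t x) = P x"
    and B: "block i T \<subseteq> Collect P" "block i (set_bit t T) \<subseteq> Collect P"
    and T: "\<not> bit T t" and t: "i \<le> t"
    and a: "complex_of_real (cos (\<theta> / 2)) * b = a"
    and b': "complex_of_real (- sin (\<theta> / 2)) * b = b'"
  shows "act P t (gate_RY \<theta>) (two_level a A b (block i (set_bit t T)))
    = two_level a (A \<union> block i (set_bit t T)) b' (block i T)"
proof
  fix x
  have u: "unset_bit t x \<notin> block i (set_bit t T)"
    using t by (auto simp: block_def bit_simps)
  have s: "set_bit t x \<in> block i (set_bit t T) \<longleftrightarrow> (if bit x t then x \<in> block i (set_bit t T) else x \<in> block i T)"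
    using t T by (auto simp: block_def bit_simps)
  have b: "x \<in> block i T \<Longrightarrow> \<not> bit x t" "x \<in> block i (set_bit t T) \<Longrightarrow> bit x t"
    using t T by (auto simp: block_def bit_simps)
  show "act P t (gate_RY \<theta>) (two_level a A b (block i (set_bit t T))) x
    = two_level a (A \<union> block i (set_bit t T)) b' (block i T) x"
    using A[of x] A[of "unset_bit t x"] A[of "set_bit t x"] P[of x] u s B b set_bit_idle[of x t] a b'
    by (cases "bit x t"; cases "P x")
      (auto simp: act_def two_level_def gate_RY_def mat_of_rows_list_def)
qed

abbreviation apply_gates :: "complex vec \<Rightarrow> complex mat list \<Rightarrow> complex vec" where
  "apply_gates \<equiv> foldl (\<lambda>v G. G *\<^sub>v v)"

text \<open>Each gate doubles the block and divides its amplitude by \<open>sqrt 2\<close>. Leaving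
  \<open>G\<close> and \<open>P\<close> open covers both plain and conditioned gates.\<close>

lemma apply_H_upto:
  assumes "i0 \<le> i1"
    and G: "\<And>i f. i0 \<le> i \<Longrightarrow> i < i1 \<Longrightarrow> G i *\<^sub>v vec N f = vec N (act P i gate_H f)"
    and A: "\<And>x. P x \<Longrightarrow> x \<notin> A"
    and P: "\<And>i x. i0 \<le> i \<Longrightarrow> i < i1 \<Longrightarrow> P (unset_bit i x) = P x"
      "\<And>i x. i0 \<le> i \<Longrightarrow> i < i1 \<Longrightarrow> P (set_bit i x) = P x"
    and B: "block i1 T \<subseteq> Collect P" and T: "\<And>i. i0 \<le> i \<Longrightarrow> i < i1 \<Longrightarrow> \<not> bit T i"
  shows "apply_gates (vec N (two_level a A b (block i0 T))) (map G [i0..<i1])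
    = vec N (two_level a A (b / complex_of_real (sqrt 2) ^ (i1 - i0)) (block i1 T))"
  using assms
proof (induction i1 rule: dec_induct)
  case base
  then show ?case by simp
next
  case (step i1)
  \<comment> \<open>Blocks grow with their index, so the control condition on the larger block gives
    the one that the induction hypothesis asks for.\<close>
  have "block i1 T \<subseteq> block (Suc i1) T"
    by (auto simp: block_def)
  with step have "apply_gates (vec N (two_level a A b (block i0 T))) (map G [i0..<i1])
    = vec N (two_level a A (b / complex_of_real (sqrt 2) ^ (i1 - i0)) (block i1 T))"
    by auto
  moreover have "act P i1 gate_H (two_level a A (b / complex_of_real (sqrt 2) ^ (i1 - i0)) (block i1 T))
    = two_level a A (b / complex_of_real (sqrt 2) ^ (i1 - i0) / complex_of_real (sqrt 2)) (block (Suc i1) T)"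
    by (rule act_H_two_level) (use step in auto)
  ultimately show ?case
    using step by (simp add: Suc_diff_le mult.commute)
qed

section \<open>Sums of distinct powers of two\<close>

text \<open>The exponents are distinct, so no carry occurs: each new power sets a bit that was
  0.\<close>

lemma bit_sum_power2:
  fixes S :: "nat set"
  assumes "finite S"
  shows "bit (\<Sum>p\<in>S. 2 ^ p :: nat) i \<longleftrightarrow> i \<in> S"
  using assms
proof (induction S arbitrary: i rule: finite_induct)
  case (insert q S)
  then have "(\<Sum>p\<in>insert q S. 2 ^ p :: nat) = set_bit q (\<Sum>p\<in>S. 2 ^ p)"
    by (simp add: set_bit_eq)
  then show ?case
    by (auto simp: bit_simps insert.IH)
qed simp

lemma sum_power2_insert:
  fixes S :: "nat set"
  assumes "finite S" "q \<notin> S"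
  shows "(\<Sum>p\<in>insert q S. 2 ^ p :: nat) = set_bit q (\<Sum>p\<in>S. 2 ^ p)"
  using assms by (simp add: set_bit_eq bit_sum_power2)

section \<open>The binary expansion of \<open>M\<close> and its upper parts\<close>

text \<open>\<open>k_pos\<close> expresses that \<open>M\<close> is not a power of two.\<close>

locale binary_expansion =
  fixes n M k :: nat and l :: "nat \<Rightarrow> nat"
  assumes M: "M = (\<Sum>j = 0..k. 2 ^ l j)"
    and mono: "strict_mono_on {0..k} l"
    and l_k_less: "l k < n"
    and k_pos: "0 < k"
begin

text \<open>For \<open>m \<le> k\<close> this is \<open>M - partial_M l m\<close>. Summing over the
  set of exponents lets its bits be read off directly.\<close>

definition rest :: "nat \<Rightarrow> nat" where
  "rest m = (\<Sum>p \<in> l ` {m<..k}. 2 ^ p)"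

lemma l_less: "i < j \<Longrightarrow> j \<le> k \<Longrightarrow> l i < l j"
  using mono by (auto simp: strict_mono_on_def)

lemma l_le: "i \<le> j \<Longrightarrow> j \<le> k \<Longrightarrow> l i \<le> l j"
  using l_less[of i j] by (cases "i = j") auto

lemma l_less_n: "j \<le> k \<Longrightarrow> l j < n"
  using l_le[of j k] l_k_less by simp

lemma bit_rest: "bit (rest m) i \<longleftrightarrow> (\<exists>j. m < j \<and> j \<le> k \<and> i = l j)"
  by (auto simp: rest_def bit_sum_power2)

lemma bit_rest_l: "m < j \<Longrightarrow> j \<le> k \<Longrightarrow> bit (rest m) (l j)"
  by (auto simp: bit_rest)

lemma not_bit_rest: "m \<le> k \<Longrightarrow> i \<le> l m \<Longrightarrow> \<not> bit (rest m) i"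
  using l_less by (force simp: bit_rest)

lemma not_bit_rest_Suc: "m < k \<Longrightarrow> i \<le> l (Suc m) \<Longrightarrow> \<not> bit (rest (Suc m)) i"
  by (simp add: not_bit_rest)

lemma rest_k: "rest k = 0"
  by (simp add: rest_def)

text \<open>Puts the active block of round \<open>m\<close> in the form with bit
  \<open>l (Suc m)\<close> set from which \<open>act_RY_two_level\<close> starts.\<close>

lemma rest_eq_set_bit:
  assumes "m < k"
  shows "rest m = set_bit (l (Suc m)) (rest (Suc m))"
proof -
  have "{m<..k} = insert (Suc m) {Suc m<..k}"
    using assms by auto
  moreover have "l (Suc m) \<notin> l ` {Suc m<..k}"
    using l_less by fastforce
  ultimately show ?thesis
    by (simp only: rest_def image_insert) (simp add: sum_power2_insert del: sum.insert)
qed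

lemma rest_Suc:
  assumes "m < k"
  shows "rest m = rest (Suc m) + 2 ^ l (Suc m)"
  using rest_eq_set_bit[OF assms] not_bit_rest_Suc[OF assms] by (simp add: set_bit_eq)

lemma partial_M_eq_sum: "partial_M l m = (\<Sum>j = 0..m. 2 ^ l j)"
  by (induction m) simp_all

lemma partial_M_plus_rest: "m \<le> k \<Longrightarrow> partial_M l m + rest m = M"
proof (induction rule: inc_induct)
  case base
  show ?case by (simp add: rest_k M partial_M_eq_sum)
next
  case (step m)
  then show ?case by (simp add: rest_Suc)
qed

text \<open>\<open>tail m\<close> is \<open>M - M\<^bsub>m-1\<^esub>\<close>, with \<open>M\<^bsub>-1\<^esub> = 0\<close>.\<close>

definition tail :: "nat \<Rightarrow> nat" where
  "tail m = rest m + 2 ^ l m"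

lemma tail_pos: "0 < tail m"
  by (simp add: tail_def)

lemma tail_Suc: "m < k \<Longrightarrow> tail (Suc m) = rest m"
  by (simp add: tail_def rest_Suc)

lemma tail_0: "tail 0 = M"
  using partial_M_plus_rest[of 0] by (simp add: tail_def)

lemma M_pos: "0 < M"
  using tail_0 tail_pos[of 0] by simp

section \<open>Rotation angles\<close>

text \<open>With M_{-1} = 0 both cases of the definition divide by M - M_{m-1}, which is
  \<open>tail m\<close>.\<close>

lemma rotation_angle_eq:
  assumes "m < k"
  shows "rotation_angle M l m = - 2 * arccos (sqrt (2 ^ l m / real (tail m)))"
proof (cases m)
  case (Suc i)
  have "real M - real (partial_M l i) = real (rest i)"
    using partial_M_plus_rest[of i] assms Suc by linarith
  then show ?thesis
    using assms Suc by (simp add: rotation_angle_def tail_Suc)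
qed (simp add: rotation_angle_def tail_0)

lemma cos_rotation_angle:
  assumes "m < k"
  shows "cos (rotation_angle M l m / 2) = sqrt (2 ^ l m / real (tail m))"
proof -
  have "0 \<le> 2 ^ l m / real (tail m)" "2 ^ l m / real (tail m) \<le> 1"
    by (simp_all add: tail_def divide_le_eq_1 add_pos_nonneg add_nonneg_pos)
  then show ?thesis
    by (simp add: rotation_angle_eq[OF assms] cos_arccos_abs)
qed

text \<open>The minus sign in the angle makes this value positive; its square is the complement of
  the squared cosine, and \<open>tail m - 2 ^ l m = rest m\<close>.\<close>

lemma sin_rotation_angle:
  assumes "m < k"
  shows "- sin (rotation_angle M l m / 2) = sqrt (real (rest m) / real (tail m))"
proof -
  have r: "0 \<le> 2 ^ l m / real (tail m)" "2 ^ l m / real (tail m) \<le> 1"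
    by (simp_all add: tail_def divide_le_eq_1 add_pos_nonneg add_nonneg_pos)
  then have "- sin (rotation_angle M l m / 2) = sqrt (1 - 2 ^ l m / real (tail m))"
    by (simp add: rotation_angle_eq[OF assms] sin_arccos_abs)
  also have "1 - 2 ^ l m / real (tail m) = real (rest m) / real (tail m)"
  proof -
    have "real (rest m) = real (tail m) - 2 ^ l m"
      by (simp add: tail_def)
    then show ?thesis
      by (simp add: diff_divide_distrib tail_pos)
  qed
  finally show ?thesis .
qed

section \<open>The state before each round\<close>

text \<open>\<open>block (l j) (rest j)\<close> is the interval of length \<open>2 ^ l j\<close> starting at \<open>M - M\<^sub>j\<close>.\<close>

definition settled :: "nat \<Rightarrow> nat set" where
  "settled m = (\<Union>j<m. block (l j) (rest j))"

text \<open>The weight not yet settled is \<open>tail m / M\<close>, spread evenly over the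
  \<open>2 ^ l m\<close> states of the active block.\<close>

definition amp :: "nat \<Rightarrow> real" where
  "amp m = sqrt (real (tail m) / (real M * 2 ^ l m))"

text \<open>The state before round \<open>m\<close>, where round 0 begins with the unconditioned
  rotation; \<open>state k\<close> is the final state.\<close>

definition state :: "nat \<Rightarrow> nat \<Rightarrow> complex" where
  "state m = two_level (complex_of_real (1 / sqrt (real M))) (settled m)
    (complex_of_real (amp m)) (block (l m) (rest m))"

text \<open>The intervals are adjacent because
  \<open>rest m = rest (Suc m) + 2 ^ l (Suc m)\<close>.\<close>

lemma settled_Suc: "m \<le> k \<Longrightarrow> settled (Suc m) = {rest m..<M}"
proof (induction m)
  case 0
  have "block (l 0) (rest 0) = {rest 0..<rest 0 + 2 ^ l 0}"
    by (rule block_eq_atLeastLessThan) (simp add: not_bit_rest)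
  then show ?case
    using tail_0 by (simp add: settled_def tail_def lessThan_Suc)
next
  case (Suc m)
  have "block (l (Suc m)) (rest (Suc m)) = {rest (Suc m)..<rest (Suc m) + 2 ^ l (Suc m)}"
    by (rule block_eq_atLeastLessThan) (use Suc not_bit_rest in simp)
  moreover have "settled (Suc (Suc m)) = settled (Suc m) \<union> block (l (Suc m)) (rest (Suc m))"
    by (auto simp: settled_def lessThan_Suc)
  moreover have "rest m \<le> M"
    using partial_M_plus_rest[of m] Suc.prems by simp
  ultimately show ?case
    using Suc by (auto simp: rest_Suc)
qed

text \<open>Elements of the interval with index \<open>j < m\<close> agree with
  \<open>rest j\<close> from bit \<open>l j\<close> on, and \<open>rest j\<close> contains
  \<open>2 ^ l m\<close>. Hence a control on \<open>l m\<close> spares all settled states.\<close>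

lemma bit_settled:
  assumes "m \<le> k" "x \<in> settled m"
  shows "bit x (l m)"
  using assms l_le bit_rest_l by (auto simp: settled_def block_def less_imp_le)

lemma amp_cos:
  assumes "m < k"
  shows "cos (rotation_angle M l m / 2) * amp m = 1 / sqrt (real M)"
  using tail_pos[of m]
  by (simp add: cos_rotation_angle[OF assms] amp_def flip: real_sqrt_mult real_sqrt_divide)
    (simp add: real_sqrt_divide)

text \<open>The rotation leaves the weight \<open>rest m / M\<close>, where
  \<open>rest m = tail (Suc m)\<close>, and the Hadamards enlarge the block from
  \<open>2 ^ l m\<close> to \<open>2 ^ l (Suc m)\<close> states.\<close>

lemma amp_sin:
  assumes "m < k"
  shows "- sin (rotation_angle M l m / 2) * amp m / sqrt 2 ^ (l (Suc m) - l m) = amp (Suc m)"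
proof -
  have "- sin (rotation_angle M l m / 2) * amp m / sqrt 2 ^ (l (Suc m) - l m)
      = sqrt (real (rest m) / real (tail m) * (real (tail m) / (real M * 2 ^ l m))
          / 2 ^ (l (Suc m) - l m))"
    unfolding sin_rotation_angle[OF assms] amp_def
    by (simp only: real_sqrt_mult real_sqrt_divide real_sqrt_power)
  also have "real (rest m) / real (tail m) * (real (tail m) / (real M * 2 ^ l m))
          / 2 ^ (l (Suc m) - l m) = real (rest m) / (real M * (2 ^ l m * 2 ^ (l (Suc m) - l m)))"
    using tail_pos[of m] by simp
  also have "2 ^ l m * 2 ^ (l (Suc m) - l m) = (2 ^ l (Suc m) :: real)"
    using l_le[of m "Suc m"] assms by (simp flip: power_add)
  finally show ?thesis
    using assms by (simp add: amp_def tail_Suc)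
qed

text \<open>The disjunct \<open>m = 0\<close> makes the lemma serve the first rotation too, which is
  unconditioned: nothing is settled then.\<close>

lemma round_correct:
  assumes m: "m < k"
    and R: "\<And>f. R *\<^sub>v vec N f = vec N (act (\<lambda>x. m = 0 \<or> \<not> bit x (l m)) (l (Suc m))
      (gate_RY (rotation_angle M l m)) f)"
    and G: "\<And>i f. l m \<le> i \<Longrightarrow> i < l (Suc m) \<Longrightarrow>
      G i *\<^sub>v vec N f = vec N (act (\<lambda>x. \<not> bit x (l (Suc m))) i gate_H f)"
  shows "apply_gates (vec N (state m)) (R # map G [l m..<l (Suc m)]) = vec N (state (Suc m))"
proof -
  define \<theta> where "\<theta> = rotation_angle M l m"
  have ll: "l m < l (Suc m)"
    using m by (simp add: l_less)
  have "act (\<lambda>x. m = 0 \<or> \<not> bit x (l m)) (l (Suc m)) (gate_RY \<theta>) (state m)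
    = two_level (complex_of_real (1 / sqrt (real M)))
        (settled m \<union> block (l m) (set_bit (l (Suc m)) (rest (Suc m))))
        (complex_of_real (- sin (\<theta> / 2) * amp m)) (block (l m) (rest (Suc m)))"
    unfolding state_def rest_eq_set_bit[OF m]
  proof (rule act_RY_two_level)
    show "x \<notin> settled m" if "m = 0 \<or> \<not> bit x (l m)" for x
      using that bit_settled[of m x] m by (auto simp: settled_def)
    show "complex_of_real (cos (\<theta> / 2)) * complex_of_real (amp m) =
        complex_of_real (1 / sqrt (real M))"
      using amp_cos[OF m] by (simp only: \<theta>_def flip: of_real_mult)
    show "complex_of_real (- sin (\<theta> / 2)) * complex_of_real (amp m) =
        complex_of_real (- sin (\<theta> / 2) * amp m)"
      by (rule of_real_mult[symmetric])
  qed (use ll m not_bit_rest[of m "l m"] not_bit_rest_Suc[of m] rest_eq_set_bit[OF m]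
        in \<open>auto simp: block_def bit_simps\<close>)
  \<comment> \<open>The half that kept bit \<open>l (Suc m)\<close> is
    \<open>block (l m) (rest m)\<close>, the interval that this round settles.\<close>
  also have "settled m \<union> block (l m) (set_bit (l (Suc m)) (rest (Suc m))) = settled (Suc m)"
    by (auto simp: settled_def lessThan_Suc rest_eq_set_bit[OF m])
  finally have "R *\<^sub>v vec N (state m) =
    vec N (two_level (complex_of_real (1 / sqrt (real M))) (settled (Suc m))
        (complex_of_real (- sin (\<theta> / 2) * amp m)) (block (l m) (rest (Suc m))))"
    unfolding R \<theta>_def[symmetric] by (rule arg_cong)
  \<comment> \<open>The control is now \<open>l (Suc m)\<close>: it is 1 on every settled state and
    0 on the part still to be spread.\<close>
  moreover have "apply_gates
      (vec N (two_level (complex_of_real (1 / sqrt (real M))) (settled (Suc m))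
        (complex_of_real (- sin (\<theta> / 2) * amp m)) (block (l m) (rest (Suc m)))))
      (map G [l m..<l (Suc m)])
    = vec N (two_level (complex_of_real (1 / sqrt (real M))) (settled (Suc m))
        (complex_of_real (- sin (\<theta> / 2) * amp m) / complex_of_real (sqrt 2) ^ (l (Suc m) - l m))
        (block (l (Suc m)) (rest (Suc m))))"
    by (rule apply_H_upto[where P = "\<lambda>x. \<not> bit x (l (Suc m))"])
      (use ll m G bit_settled[of "Suc m"] not_bit_rest_Suc[of m] in \<open>auto simp: block_def bit_simps\<close>)
  moreover have "complex_of_real (- sin (\<theta> / 2) * amp m) / complex_of_real (sqrt 2) ^ (l (Suc m) - l m)
      = complex_of_real (amp (Suc m))"
    unfolding amp_sin[OF m, symmetric] \<theta>_def by (simp only: of_real_divide of_real_power)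
  ultimately show ?thesis
    by (simp only: state_def list.map foldl_Cons)
qed

section \<open>The phases of the circuit\<close>

text \<open>The positions are distinct, so each X meets a 0 bit. For \<open>j = k\<close> the sum is
  \<open>rest 0\<close>.\<close>

lemma apply_X_upto:
  assumes "j \<le> k"
  shows "apply_gates (ket n 0) (map (\<lambda>j. on_qubit n (l j) gate_X) [1..<j + 1])
    = vec (2 ^ n) (two_level 0 {} 1 (block 0 (\<Sum>p \<in> l ` {0<..j}. 2 ^ p)))"
  using assms
proof (induction j)
  case 0
  have "block 0 0 = {0}"
    by (auto simp: block_def intro!: bit_eqI)
  then show ?case
    by (intro eq_vecI) (simp_all add: ket_eq_unit_vec two_level_def)
next
  case (Suc j)
  let ?S = "l ` {0<..j}"
  have S: "l (Suc j) \<notin> ?S"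
    using Suc.prems l_less[of _ "Suc j"] by (auto simp: less_Suc_eq_le) (metis less_irrefl less_Suc_eq_le)
  have "{0<..Suc j} = insert (Suc j) {0<..j}"
    by auto
  then have "(\<Sum>p \<in> l ` {0<..Suc j}. 2 ^ p :: nat) = set_bit (l (Suc j)) (\<Sum>p \<in> ?S. 2 ^ p)"
    using S by (simp only: image_insert) (simp add: sum_power2_insert del: sum.insert)
  moreover have "\<not> bit (\<Sum>p \<in> ?S. 2 ^ p :: nat) (l (Suc j))"
    using S by (simp add: bit_sum_power2)
  ultimately show ?case
    using Suc by (simp add: on_qubit_mult_vec l_less_n act_X_two_level)
qed

lemma initial_state:
  "apply_gates (ket n 0) (map (\<lambda>j. on_qubit n (l j) gate_X) [1..<k + 1]
     @ (if l 0 > 0 then map (\<lambda>i. on_qubit n i gate_H) [0..<l 0] else []))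
   = vec (2 ^ n) (state 0)"
proof -
  have X: "apply_gates (ket n 0) (map (\<lambda>j. on_qubit n (l j) gate_X) [1..<k + 1])
      = vec (2 ^ n) (two_level 0 {} 1 (block 0 (rest 0)))"
    unfolding rest_def by (rule apply_X_upto) simp
  have "apply_gates (vec (2 ^ n) (two_level 0 {} 1 (block 0 (rest 0))))
      (map (\<lambda>i. on_qubit n i gate_H) [0..<l 0])
    = vec (2 ^ n) (two_level 0 {} (1 / complex_of_real (sqrt 2) ^ (l 0 - 0)) (block (l 0) (rest 0)))"
    by (rule apply_H_upto[where P = "\<lambda>_. True"])
      (use l_less_n[of 0] not_bit_rest[of 0] in \<open>auto simp: on_qubit_mult_vec\<close>)
  \<comment> \<open>\<open>settled 0\<close> is empty, so the level on it may change from 0 to the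
    final amplitude; \<open>amp 0\<close> is \<open>1 / sqrt (2 ^ l 0)\<close> because
    \<open>tail 0 = M\<close>.\<close>
  moreover have "two_level 0 {} (1 / complex_of_real (sqrt 2) ^ (l 0 - 0)) (block (l 0) (rest 0)) = state 0"
    using M_pos by (auto simp: state_def two_level_def settled_def amp_def tail_0 real_sqrt_divide real_sqrt_power)
  ultimately show ?thesis
    using X by (cases "l 0 > 0") simp_all
qed

text \<open>Starts at \<open>state 1\<close> because the rotation of round 0 has no control and is
  treated separately.\<close>

lemma all_rounds:
  assumes "1 \<le> j" "j \<le> k"
  shows "apply_gates (vec (2 ^ n) (state 1)) (concat (map (\<lambda>m.
         on_qubit_if0 n (l m) (l (m + 1)) (gate_RY (rotation_angle M l m))
         # map (\<lambda>i. on_qubit_if0 n (l (m + 1)) i gate_H) [l m..<l (m + 1)])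
       [1..<j])) = vec (2 ^ n) (state j)"
  using assms
proof (induction j rule: dec_induct)
  case (step j)
  have "apply_gates (vec (2 ^ n) (state j))
      (on_qubit_if0 n (l j) (l (Suc j)) (gate_RY (rotation_angle M l j))
       # map (\<lambda>i. on_qubit_if0 n (l (Suc j)) i gate_H) [l j..<l (Suc j)])
    = vec (2 ^ n) (state (Suc j))"
    by (rule round_correct)
      (use step l_less_n[of j] l_less_n[of "Suc j"] in \<open>simp_all add: on_qubit_if0_mult_vec\<close>)
  then show ?case
    using step by simp
qed simp

lemma gates_carrier: "G \<in> set (uniform_gates n M k l) \<Longrightarrow> G \<in> carrier_mat (2 ^ n) (2 ^ n)"
proof -
  assume "G \<in> set (uniform_gates n M k l)"
  moreover have "l 0 < n" "l 1 < n"
    using l_less_n k_pos by auto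
  moreover have "l m < n" "l (Suc m) < n" if "m < k" for m
    using l_less_n that by auto
  ultimately show ?thesis
    by (force simp: uniform_gates_def intro!: on_qubit_carrier on_qubit_if0_carrier l_less_n
        split: if_splits)
qed

text \<open>The last active block already has the final amplitude, since
  \<open>tail k = 2 ^ l k\<close>; together with the settled intervals it fills [0, M).\<close>

lemma final_state: "vec (2 ^ n) (state k) = vec (2 ^ n) (\<lambda>x. if x < M then complex_of_real (1 / sqrt (real M)) else 0)"
proof -
  have "settled k \<union> block (l k) (rest k) = {0..<M}"
    using settled_Suc[of k] by (auto simp: rest_k settled_def lessThan_Suc)
  moreover have "amp k = 1 / sqrt (real M)"
    by (simp add: amp_def tail_def rest_k real_sqrt_divide)
  ultimately have "state k x = (if x < M then complex_of_real (1 / sqrt (real M)) else 0)" for x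
    by (auto simp: state_def two_level_def set_eq_iff)
  then show ?thesis by presburger
qed

lemma uniform_unitary_correct:
  "uniform_unitary n M k l *\<^sub>v ket n 0 = vec (2 ^ n) (\<lambda>x. if x < M then complex_of_real (1 / sqrt (real M)) else 0)"
proof -
  have first: "apply_gates (vec (2 ^ n) (state 0)) (on_qubit n (l 1) (gate_RY (rotation_angle M l 0))
      # map (\<lambda>i. on_qubit_if0 n (l 1) i gate_H) [l 0..<l 1]) = vec (2 ^ n) (state 1)"
    using round_correct[of 0 "on_qubit n (l 1) (gate_RY (rotation_angle M l 0))" "2 ^ n"
        "\<lambda>i. on_qubit_if0 n (l 1) i gate_H"] k_pos l_less_n[of 1]
    by (simp add: on_qubit_mult_vec on_qubit_if0_mult_vec)
  have "uniform_unitary n M k l *\<^sub>v ket n 0 = apply_gates (ket n 0) (uniform_gates n M k l)"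
    unfolding uniform_unitary_def
    by (rule circuit_mult_vec) (auto intro: gates_carrier carrier_vecI)
  also have "\<dots> = vec (2 ^ n) (state k)"
    using initial_state first all_rounds[of k] k_pos
    unfolding uniform_gates_def foldl_append by simp
  finally show ?thesis
    by (simp only: final_state)
qed

end

section \<open>The uniform superposition as a sum of basis states\<close>

lemma scaled_sum_kets:
  assumes "M \<le> 2 ^ n"
  shows "c \<cdot>\<^sub>v finsum_vec TYPE(complex) (2 ^ n) (ket n) {0..<M} =
    vec (2 ^ n) (\<lambda>x. if x < M then c else 0)"
proof (rule eq_vecI)
  have ket: "ket n \<in> {0..<M} \<rightarrow> carrier_vec (2 ^ n)"
    by (auto intro: carrier_vecI)
  have dim: "dim_vec (finsum_vec TYPE(complex) (2 ^ n) (ket n) {0..<M}) = 2 ^ n"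
    using finsum_vec_closed[OF ket] by (rule carrier_vecD)
  then show "dim_vec (c \<cdot>\<^sub>v finsum_vec TYPE(complex) (2 ^ n) (ket n) {0..<M}) =
      dim_vec (vec (2 ^ n) (\<lambda>x. if x < M then c else 0))"
    by simp
  fix x assume "x < dim_vec (vec (2 ^ n) (\<lambda>x. if x < M then c else 0))"
  then have x: "x < 2 ^ n" by simp
  have "finsum_vec TYPE(complex) (2 ^ n) (ket n) {0..<M} $ x = (\<Sum>j\<in>{0..<M}. ket n j $ x)"
    by (rule index_finsum_vec) (use x ket in auto)
  also have "\<dots> = (\<Sum>j\<in>{0..<M}. if x = j then 1 else 0)"
    using x assms by (intro sum.cong) (auto simp: ket_eq_unit_vec)
  also have "\<dots> = (if x < M then 1 else 0)"
    by simp
  finally show "(c \<cdot>\<^sub>v finsum_vec TYPE(complex) (2 ^ n) (ket n) {0..<M}) $ x =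
      vec (2 ^ n) (\<lambda>x. if x < M then c else 0) $ x"
    using x dim by simp
qed

theorem mainTheorem2:
  fixes n M k :: nat and l :: "nat \<Rightarrow> nat"
  assumes "n \<ge> 1"
    and "2 < M" and "M < 2 ^ n"
    and "\<nexists>p :: nat. M = 2 ^ p"
    and "M = (\<Sum>j = 0..k. 2 ^ l j)"
    and "strict_mono_on {0..k} l"
    and "l k \<le> n - 1"
  shows "uniform_unitary n M k l *\<^sub>v ket n 0 =
    complex_of_real (1 / sqrt (real M)) \<cdot>\<^sub>v
      finsum_vec TYPE(complex) (2 ^ n) (ket n) {0..<M}"
proof -
  \<comment> \<open>A single summand would make \<open>M\<close> the power
    \<open>2 ^ l 0\<close>.\<close>
  have "k \<noteq> 0"
  proof
    assume "k = 0"
    then show False using assms(4,5) by simp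
  qed
  then interpret binary_expansion n M k l
    using assms by unfold_locales auto
  show ?thesis
    using uniform_unitary_correct scaled_sum_kets assms(3) less_imp_le by metis
qed

end
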